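(* The following equalities hold: (1) $\displaystyle\sum_{n\ 3\text{-free}}\frac{\mu_3(n)}{n^2}=\frac{45045}{691\pi^4}$; (2) $\displaystyle\sum_{n\ 4\text{-free}}\frac{\mu_4(n)}{n^2}=\frac{630}{\pi^6}$; (3) $\displaystyle\sum_{n\ 5\text{-free}}\frac{\mu_5(n)}{n^2}=\frac{1091215125}{174611\,\pi^8}$. In each part the sum is over all positive integers $n$ that are $r$-free, with $r=3,4,5$ respectively.
   Context: For a positive integer $r$, a positive integer $n$ is called $r$-free if there is no prime $p$ such that $p^r$ divides $n$. The Möbius function of rank $r$ is the arithmetic function $\mu_r:\{1,2,3,\dots\}\to\{-1,0,1\}$ defined by $\mu_r(1)=1$; $\mu_r(n)=(-1)^{m_1+\cdots+m_k}$ if $n=p_1^{m_1}\cdots p_k^{m_k}$ (distinct primes $p_j$, all $m_j\ge 1$) with all $m_j<r$; and $\mu_r(n)=0$ if $p^r\mid n$ for some prime $p$. *)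

theory Defs
  imports "HOL-Analysis.Analysis" "HOL-Computational_Algebra.Primes"
begin

definition r_free :: "nat \<Rightarrow> nat \<Rightarrow> bool" where
  "r_free r n \<longleftrightarrow> n > 0 \<and> \<not> (\<exists>p. prime p \<and> p ^ r dvd n)"

text \<open>The rank \<open>r\<close> is meant to be positive. The function is meant for positive arguments;
  for \<open>r > 0\<close> its value at \<open>0\<close> is \<open>0\<close>.\<close>

definition moebius_rank :: "nat \<Rightarrow> nat \<Rightarrow> int" where
  "moebius_rank r n =
     (if n = 1 then 1
      else if \<exists>p. prime p \<and> p ^ r dvd n then 0
      else (-1) ^ (\<Sum>p\<in>prime_factors n. multiplicity p n))"

end

theory Submission imports Defs "HOL-Computational_Algebra.Nth_Powers"
begin

text \<open>On \<open>r\<close>-free integers \<open>\<mu>\<^sub>r\<close> agrees with the Liouville function \<open>\<lambda>\<close>, which is completely multiplicative.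
  Every positive integer is uniquely \<open>d ^ r * m\<close> with \<open>m\<close> being \<open>r\<close>-free, and
  \<open>\<lambda> (d ^ r * m) = \<lambda> d ^ r * \<lambda> m\<close>. Hence, for \<open>s \<ge> 2\<close>, where all series converge absolutely,
  \<open>\<Sum>\<^sub>n \<lambda> n / n ^ s\<close> is the product of \<open>\<Sum>\<^sub>d \<lambda> d ^ r / d ^ (r * s)\<close> and the sum of
  \<open>\<mu>\<^sub>r m / m ^ s\<close> over the \<open>r\<close>-free \<open>m\<close>.

  The two Liouville series are values of \<open>\<zeta>\<close>: the divisor sum of \<open>\<lambda>\<close> is the indicator function of the squares
  (\<open>liouville_divisor_sum\<close>), so \<open>\<Sum>\<^sub>n \<lambda> n / n ^ s = \<zeta>(2s) / \<zeta>(s)\<close> (\<open>has_sum_liouville\<close>), and \<open>\<lambda> d ^ r\<close>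
  is \<open>1\<close> or \<open>\<lambda> d\<close> according to the parity of \<open>r\<close>. This evaluates the \<open>\<mu>\<^sub>r\<close> series for every positive \<open>r\<close>
  (\<open>has_sum_moebius_rank\<close>): it is \<open>\<zeta>(2s) / (\<zeta>(s) \<zeta>(rs))\<close> for even \<open>r\<close> and
  \<open>\<zeta>(2s) \<zeta>(rs) / (\<zeta>(s) \<zeta>(2rs))\<close> for odd \<open>r\<close>.

  For \<open>s = 2\<close> and \<open>r = 3, 4, 5\<close> only \<open>\<zeta>\<close> at even arguments up to \<open>20\<close> enters. These values follow from
  \<open>\<zeta>(2) = \<pi>\<^sup>2 / 6\<close> by the recurrence
  \<open>(k + 1/2) \<zeta>(2k) = \<Sum>\<^sub>j \<zeta>(2j) \<zeta>(2k - 2j)\<close> with \<open>1 \<le> j < k\<close> (\<open>zeta_nat_even_recurrence\<close>), which comes from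
  summing a partial fraction identity over all pairs \<open>(m, n)\<close>.\<close>

section \<open>The Liouville function\<close>

definition liouville :: "nat \<Rightarrow> int" where
  "liouville n = (-1) ^ size (prime_factorization n)"

lemma liouville_1 [simp]: "liouville (Suc 0) = 1"
  by (simp add: liouville_def)

lemma liouville_mult:
  assumes "m > 0" "n > 0"
  shows "liouville (m * n) = liouville m * liouville n"
  using assms by (simp add: liouville_def prime_factorization_mult power_add)

lemma liouville_power: "n > 0 \<Longrightarrow> liouville (n ^ k) = liouville n ^ k"
  by (induction k) (simp_all add: liouville_mult)

lemma liouville_prime: "prime p \<Longrightarrow> liouville p = -1"
  by (simp add: liouville_def prime_factorization_prime)

lemma liouville_cases: "liouville n = 1 \<or> liouville n = -1"
  by (simp add: liouville_def minus_one_power_iff)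

lemma liouville_power_parity: "liouville n ^ r = (if even r then 1 else liouville n)"
  using liouville_cases[of n] by auto

lemma sum_minus_one_power_atMost:
  "(\<Sum>i\<le>e. (-1) ^ i) = (if even e then 1 else 0 :: int)"
  by (induction e) auto

text \<open>A divisor of \<open>p ^ e * m\<close> is determined by its \<open>p\<close>-part and its \<open>p\<close>-free part, so divisor sums of
  multiplicative functions split off one prime at a time.\<close>

lemma bij_betw_divisors_prime_power_mult:
  fixes p m :: nat
  assumes p: "prime p" and m: "\<not> p dvd m"
  shows "bij_betw (\<lambda>(i, d). p ^ i * d) ({..e} \<times> {d. d dvd m}) {d. d dvd p ^ e * m}"
proof (rule bij_betw_imageI)
  have pd: "\<not> p dvd d" if "d dvd m" for d
    using that m by (meson dvd_trans)
  have mult: "multiplicity p (p ^ i * d) = i" if "d dvd m" for i d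
    using p pd[OF that] by (intro multiplicity_eqI) (auto simp: prime_gt_0_nat)
  show "inj_on (\<lambda>(i, d). p ^ i * d) ({..e} \<times> {d. d dvd m})"
  proof (rule inj_onI, clarsimp)
    fix i j c d assume *: "p ^ i * c = p ^ j * d" "c dvd m" "d dvd m"
    hence "i = j" using mult by metis
    thus "i = j \<and> c = d" using * p by (auto simp: prime_gt_0_nat)
  qed
  show "(\<lambda>(i, d). p ^ i * d) ` ({..e} \<times> {d. d dvd m}) = {d. d dvd p ^ e * m}"
  proof (intro equalityI subsetI)
    fix x assume "x \<in> (\<lambda>(i, d). p ^ i * d) ` ({..e} \<times> {d. d dvd m})"
    thus "x \<in> {d. d dvd p ^ e * m}" by (auto intro!: mult_dvd_mono le_imp_power_dvd)
  next
    fix x assume "x \<in> {d. d dvd p ^ e * m}"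
    then have "x dvd p ^ e * m" by simp
    then obtain a b where ab: "x = a * b" "a dvd p ^ e" "b dvd m"
      by (metis division_decomp)
    then obtain i where "i \<le> e" "a = p ^ i" using p by (auto simp: divides_primepow_nat)
    thus "x \<in> (\<lambda>(i, d). p ^ i * d) ` ({..e} \<times> {d. d dvd m})" using ab by force
  qed
qed

text \<open>Splitting off the full power \<open>p ^ e\<close> of one prime from \<open>n\<close> leaves the factor
  \<open>1 - 1 + 1 - \<dots>\<close> with \<open>e + 1\<close> terms, which is the indicator of \<open>e\<close> being even; induction on \<open>n\<close> collects
  these conditions into \<open>n\<close> being a square.\<close>

theorem liouville_divisor_sum:
  assumes "n > 0"
  shows "(\<Sum>d | d dvd n. liouville d) = of_bool (is_nth_power 2 n)"
  using assms
proof (induction n rule: less_induct)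
  case (less n)
  show ?case
  proof (cases "n = 1")
    case False
    then obtain p where p: "prime p" "p dvd n" using prime_factor_nat by blast
    obtain m where m: "n = p ^ multiplicity p n * m" "\<not> p dvd m"
      using multiplicity_decompose'[of n p] less.prems p by (metis not_prime_unit neq0_conv)
    define e where "e = multiplicity p n"
    have n: "n = p ^ e * m" using m e_def by simp
    have e: "e > 0" using p less.prems by (simp add: e_def prime_multiplicity_gt_zero_iff)
    have m0: "m > 0" using n less.prems by (cases m) auto
    have "1 < p ^ e" using e prime_gt_1_nat[OF p(1)] by (simp only: one_less_power)
    hence mn: "m < n" using n m0 by simp
    have "(\<Sum>d | d dvd n. liouville d) = (\<Sum>(i, d)\<in>{..e} \<times> {d. d dvd m}. liouville (p ^ i * d))"
      unfolding n using sum.reindex_bij_betw[OF bij_betw_divisors_prime_power_mult[OF p(1) m(2)],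
          of liouville e] by (simp add: case_prod_unfold)
    also have "\<dots> = (\<Sum>(i, d)\<in>{..e} \<times> {d. d dvd m}. (-1) ^ i * liouville d)"
    proof (intro sum.cong refl, clarify)
      fix i d assume "d dvd m"
      hence "d > 0" using m0 by (rule dvd_pos_nat[rotated])
      thus "liouville (p ^ i * d) = (-1) ^ i * liouville d"
        using p(1) by (simp add: liouville_mult liouville_power liouville_prime prime_gt_0_nat)
    qed
    also have "\<dots> = (\<Sum>i\<le>e. (-1) ^ i) * (\<Sum>d | d dvd m. liouville d)"
      by (simp add: sum_product sum.cartesian_product)
    also have "\<dots> = of_bool (even e \<and> is_nth_power 2 m)"
      using less.IH[OF mn m0] by (simp add: sum_minus_one_power_atMost)
    also have "even e \<and> is_nth_power 2 m \<longleftrightarrow> is_nth_power 2 n"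
      unfolding n using p(1) m(2)
      by (subst is_nth_power_mult_coprime_nat_iff)
         (auto simp: is_nth_power_prime_power_nat_iff prime_imp_coprime)
    finally show ?thesis .
  qed simp
qed

section \<open>Splitting off the largest \<open>r\<close>-th power divisor\<close>

lemma moebius_rank_eq_liouville: "r_free r n \<Longrightarrow> moebius_rank r n = liouville n"
  by (auto simp: r_free_def moebius_rank_def liouville_def size_multiset_overloaded_eq
        count_prime_factorization_prime in_prime_factors_imp_prime intro!: arg_cong[where f = "\<lambda>k. (-1) ^ k"] sum.cong)

lemma multiplicity_less_if_r_free:
  assumes "r_free r n" "prime p"
  shows "multiplicity p n < r"
proof (rule multiplicity_lessI)
qed (use assms in \<open>auto simp: r_free_def\<close>)

text \<open>Division of the exponent of \<open>p\<close> in \<open>n = d ^ r * m\<close> by \<open>r\<close> has the exponent in \<open>m\<close>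
  as its remainder and the exponent in \<open>d\<close> as its quotient. So \<open>n\<close> determines \<open>d\<close>.\<close>

lemma multiplicity_power_times_r_free:
  assumes r: "r_free r m" and d: "d > 0" and p: "prime p"
  shows "multiplicity p (d ^ r * m) div r = multiplicity p d"
proof -
  have "multiplicity p (d ^ r * m) = r * multiplicity p d + multiplicity p m"
    using assms by (simp add: prime_elem_multiplicity_mult_distrib
        prime_elem_multiplicity_power_distrib r_free_def)
  thus ?thesis using multiplicity_less_if_r_free[OF r p] by simp
qed

text \<open>Take \<open>d\<close> as large as possible with \<open>d ^ r dvd n\<close>: if \<open>p ^ r\<close> divided the cofactor, \<open>d * p\<close> would be
  a larger choice.\<close>

lemma r_free_factor_exists:
  assumes n: "n > 0" and r: "r > 0"
  obtains d m where "d > 0" "r_free r m" "n = d ^ r * m"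
proof -
  define D where "D = {d. d ^ r dvd n}"
  have "D \<subseteq> {..n}"
  proof
    fix d assume "d \<in> D"
    hence "d ^ r \<le> n" using n by (auto simp: D_def dvd_imp_le)
    moreover have "d \<le> d ^ r" using r by (cases "d = 0") (auto intro: self_le_power)
    ultimately show "d \<in> {..n}" by simp
  qed
  hence fin: "finite D" by (rule finite_subset) simp
  have one: "1 \<in> D" by (simp add: D_def)
  define d where "d = Max D"
  have "d \<in> D" unfolding d_def using fin one by (intro Max_in) auto
  then obtain m where m: "n = d ^ r * m" by (auto simp: D_def)
  have d: "d > 0" using n r m by (cases d) auto
  have "r_free r m" unfolding r_free_def
  proof safe
    show "m > 0" using m n by (cases m) auto
    fix p :: nat assume p: "prime p" "p ^ r dvd m"
    hence "d * p \<in> D" using m by (auto simp: D_def power_mult_distrib)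
    hence "d * p \<le> d" unfolding d_def using fin by (intro Max_ge) auto
    thus False using d prime_gt_1_nat[OF p(1)] by simp
  qed
  thus thesis using that d m by blast
qed

theorem bij_betw_power_times_r_free:
  assumes r: "r > 0"
  shows "bij_betw (\<lambda>(d, m). d ^ r * m) ({1..} \<times> {m. r_free r m}) {1..}"
proof (rule bij_betw_imageI)
  show "inj_on (\<lambda>(d, m). d ^ r * m) ({1..} \<times> {m. r_free r m})"
  proof (rule inj_onI, clarsimp)
    fix c d m k :: nat
    assume *: "c ^ r * m = d ^ r * k" "Suc 0 \<le> c" "Suc 0 \<le> d" "r_free r m" "r_free r k"
    have pos: "c > 0" "d > 0" using *(2,3) by simp_all
    have "multiplicity p c = multiplicity p d" if p: "prime p" for p
      using multiplicity_power_times_r_free[OF *(4) pos(1) p]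
        multiplicity_power_times_r_free[OF *(5) pos(2) p]
      unfolding *(1) by simp
    with pos have "c = d" by (rule multiplicity_eq_nat)
    with *(1) pos show "c = d \<and> m = k" by simp
  qed
  show "(\<lambda>(d, m). d ^ r * m) ` ({1..} \<times> {m. r_free r m}) = {1..}"
  proof (intro equalityI subsetI)
    fix n :: nat assume "n \<in> {1..}"
    hence "n > 0" by simp
    then obtain d m where "d > 0" "r_free r m" "n = d ^ r * m"
      using r by (rule r_free_factor_exists)
    thus "n \<in> (\<lambda>(d, m). d ^ r * m) ` ({1..} \<times> {m. r_free r m})"
      by (intro image_eqI[of _ _ "(d, m)"]) auto
  qed (auto simp: r_free_def Suc_le_eq)
qed

section \<open>The zeta series at natural numbers\<close>

definition zeta_nat :: "nat \<Rightarrow> real" where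
  "zeta_nat s = (\<Sum>\<^sub>\<infinity>n\<in>{1..}. 1 / real n ^ s)"

lemma has_sum_zeta_nat:
  assumes "s \<ge> 2"
  shows "((\<lambda>n. 1 / real n ^ s) has_sum zeta_nat s) {1..}"
proof -
  have "summable (\<lambda>n. 1 / real n ^ s)"
    using inverse_power_summable[OF assms, where ?'a = real] by (simp add: field_simps)
  hence "(\<lambda>n. 1 / real n ^ s) summable_on UNIV"
    by (subst summable_on_UNIV_nonneg_real_iff) auto
  hence "(\<lambda>n. 1 / real n ^ s) summable_on {1..}"
    by (rule summable_on_subset) auto
  thus ?thesis unfolding zeta_nat_def by (rule has_sum_infsum)
qed

lemma zeta_nat_pos:
  assumes "s \<ge> 2"
  shows "zeta_nat s > 0"
proof -
  have "1 \<le> zeta_nat s"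
    using has_sum_mono'[OF has_sum_finiteI[of "{1}" _ "\<lambda>n. 1 / real n ^ s"] has_sum_zeta_nat[OF assms]]
    by simp
  thus ?thesis by simp
qed

lemma zeta_nat_2: "zeta_nat 2 = pi\<^sup>2 / 6"
proof -
  have "((\<lambda>n. 1 / real n ^ 2) has_sum zeta_nat 2) {1..}"
    by (rule has_sum_zeta_nat) simp
  also have "?this \<longleftrightarrow> ((\<lambda>n. 1 / real (Suc n) ^ 2) has_sum zeta_nat 2) UNIV"
    by (rule has_sum_reindex_bij_witness[of _ Suc "\<lambda>n. n - 1"]) auto
  finally have "(\<lambda>n. 1 / real (Suc n) ^ 2) sums zeta_nat 2" by (rule has_sum_imp_sums)
  moreover have "(\<lambda>n. 1 / real (Suc n) ^ 2) sums (pi\<^sup>2 / 6)"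
    using inverse_squares_sums by (simp add: add.commute)
  ultimately show ?thesis by (rule sums_unique2)
qed

section \<open>The recurrence for the even zeta values\<close>

lemma has_sum_times:
  fixes f g :: "_ \<Rightarrow> real"
  assumes f: "(f has_sum a) A" and g: "(g has_sum b) B"
  shows "((\<lambda>(x, y). f x * g y) has_sum (a * b)) (A \<times> B)"
proof (rule has_sum_SigmaI)
  show "((\<lambda>y. case (x, y) of (x, y) \<Rightarrow> f x * g y) has_sum (f x * b)) B" for x
    using has_sum_cmult_right[OF g] by simp
  show "((\<lambda>x. f x * b) has_sum (a * b)) A"
    using has_sum_cmult_left[OF f] .
  have f': "(\<lambda>x. norm (f x)) summable_on A" and g': "(\<lambda>x. norm (g x)) summable_on B"
    using f g summable_on_iff_abs_summable_on_real has_sum_imp_summable by blast+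
  have "(\<lambda>z. norm (case z of (x, y) \<Rightarrow> f x * g y)) summable_on A \<times> B"
    unfolding Infinite_Sum.abs_summable_on_Sigma_iff
    using f' g' by (auto simp: abs_mult infsum_cmult_right' intro!: summable_on_cmult_right
        summable_on_cmult_left)
  thus "(\<lambda>(x, y). f x * g y) summable_on A \<times> B"
    by (rule abs_summable_summable)
qed

text \<open>The next results evaluate \<open>\<Sum>\<^sub>n 1 / (n\<^sup>2 - m\<^sup>2)\<close> over positive \<open>n \<noteq> m\<close>. In all of them
  the sum formally includes \<open>n = m\<close>, where the summand is \<open>1 / 0 = 0\<close>; this saves a side condition. Since
  \<open>1 / (n\<^sup>2 - m\<^sup>2)\<close> is \<open>1 / (n - m) - 1 / (n + m)\<close> divided by \<open>2 * m\<close>, the terms up to \<open>m\<close> form the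
  negative of a harmonic sum up to \<open>2 * m\<close> with the terms \<open>i = m\<close> and \<open>i = 2 * m\<close> missing, which together contribute
  \<open>3 / (2 * m)\<close>.\<close>

lemma sum_inverse_square_difference_upto:
  fixes m :: nat
  assumes m: "m > 0"
  shows "(\<Sum>n=1..m. 1 / ((real n)\<^sup>2 - (real m)\<^sup>2)) =
           (3 / (2 * real m) - (\<Sum>i=1..2*m. 1 / real i)) / (2 * real m)"
proof -
  have eq: "1 / ((real n)\<^sup>2 - (real m)\<^sup>2) = - (1 / real (m - n) + 1 / real (n + m)) / (2 * real m)"
    if "n \<in> {1..<m}" for n
  proof -
    define a where "a = real m - real n"
    have a: "a > 0" "real m = real n + a" "real (m - n) = a" "real n > 0"
      using that by (auto simp: a_def of_nat_diff)
    have "(real n)\<^sup>2 - (real m)\<^sup>2 = - (a * (2 * real n + a))"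
      unfolding a(2) by (simp add: power2_eq_square algebra_simps)
    thus ?thesis using a by (simp add: divide_simps add_pos_pos) 
  qed
  have r1: "(\<Sum>n\<in>{1..<m}. 1 / real (m - n)) = (\<Sum>i\<in>{1..<m}. 1 / real i)"
    by (rule sum.reindex_bij_witness[of _ "\<lambda>i. m - i" "\<lambda>n. m - n"]) auto
  have r2: "(\<Sum>n\<in>{1..<m}. 1 / real (n + m)) = (\<Sum>i\<in>{m+1..<2*m}. 1 / real i)"
    by (rule sum.reindex_bij_witness[of _ "\<lambda>i. i - m" "\<lambda>n. n + m"]) auto
  have s: "{1..2*m} = insert (2*m) (insert m ({1..<m} \<union> {m+1..<2*m}))" using m by auto
  have h: "(\<Sum>i=1..2*m. 1 / real i) = 3 / (2 * real m) + (\<Sum>i\<in>{1..<m}. 1 / real i) + (\<Sum>i\<in>{m+1..<2*m}. 1 / real i)"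
    unfolding s using m by (subst sum.insert; simp)+ (subst sum.union_disjoint; auto simp: field_simps)
  have "(\<Sum>n=1..m. 1 / ((real n)\<^sup>2 - (real m)\<^sup>2)) = (\<Sum>n\<in>{1..<m}. 1 / ((real n)\<^sup>2 - (real m)\<^sup>2))"
    using m by (intro sum.mono_neutral_right) auto
  also have "\<dots> = (\<Sum>n\<in>{1..<m}. - (1 / real (m - n) + 1 / real (n + m)) / (2 * real m))"
    using eq by (rule sum.cong[OF refl])
  also have "\<dots> = - ((\<Sum>n\<in>{1..<m}. 1 / real (m - n)) + (\<Sum>n\<in>{1..<m}. 1 / real (n + m))) / (2 * real m)"
    by (simp only: sum_divide_distrib[symmetric] sum_negf sum.distrib)
  also have "\<dots> = (3 / (2 * real m) - (\<Sum>i=1..2*m. 1 / real i)) / (2 * real m)"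
    unfolding r1 r2 h by simp
  finally show ?thesis .
qed

text \<open>Each further term only moves the window of \<open>2 * m\<close> consecutive reciprocals one step up, so in the limit the
  window vanishes and \<open>3 / (4 * m\<^sup>2)\<close> remains.\<close>

lemma sum_inverse_square_difference:
  fixes m :: nat
  assumes m: "m > 0"
  shows "(\<Sum>n=1..m+N. 1 / ((real n)\<^sup>2 - (real m)\<^sup>2)) =
           (3 / (2 * real m) - (\<Sum>i=1..2*m. 1 / real (N + i))) / (2 * real m)"
proof (induction N)
  case 0
  show ?case using sum_inverse_square_difference_upto[OF m] by simp
next
  case (Suc N)
  have "(\<Sum>i=1..k. 1 / real (Suc N + i)) - (\<Sum>i=1..k. 1 / real (N + i)) =
          1 / real (Suc N + k) - 1 / real (Suc N)" for k
  proof (induction k)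
    case (Suc k)
    have "Suc N + k = N + Suc k" by simp
    thus ?case using Suc.IH by (simp del: of_nat_add of_nat_Suc)
  qed simp
  note shift = this[of "2 * m"]
  have new: "1 / ((real (m + Suc N))\<^sup>2 - (real m)\<^sup>2) =
     (1 / real (Suc N) - 1 / real (Suc N + 2*m)) / (2 * real m)"
  proof -
    define a where "a = real (Suc N)"
    have a: "a > 0" "real (m + Suc N) = real m + a" "real (Suc N + 2*m) = a + 2 * real m" by (auto simp: a_def)
    have "(real m + a)\<^sup>2 - (real m)\<^sup>2 = a * (a + 2 * real m)"
      by (simp add: power2_eq_square algebra_simps)
    moreover have "1 / a - 1 / (a + 2 * real m) = 2 * real m / (a * (a + 2 * real m))"
      using a(1) m by (subst diff_frac_eq) auto
    ultimately show ?thesis unfolding a a_def[symmetric] using m by simp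
  qed
  have "(\<Sum>n=1..m+Suc N. 1 / ((real n)\<^sup>2 - (real m)\<^sup>2)) =
     (3 / (2 * real m) - (\<Sum>i=1..2*m. 1 / real (N + i))) / (2 * real m) +
      1 / ((real (m + Suc N))\<^sup>2 - (real m)\<^sup>2)"
    using Suc.IH by simp
  also have "\<dots> = (3 / (2 * real m) - (\<Sum>i=1..2*m. 1 / real (N + i)) +
      (1 / real (Suc N) - 1 / real (Suc N + 2*m))) / (2 * real m)"
    unfolding new by (rule add_divide_distrib[symmetric])
  also have "3 / (2 * real m) - (\<Sum>i=1..2*m. 1 / real (N + i)) +
      (1 / real (Suc N) - 1 / real (Suc N + 2*m)) = 3 / (2 * real m) - (\<Sum>i=1..2*m. 1 / real (Suc N + i))"
    using shift by linarith
  finally show ?case .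
qed

text \<open>Up to reindexing by \<open>d = \<bar>n - m\<bar>\<close>, the parts above and below the diagonal are subfamilies of the
  product of two convergent series \<open>\<Sum> 1 / n\<^sup>2\<close>.\<close>

lemma summable_on_inverse_squared_difference:
  "(\<lambda>(m, n). 1 / (real m)\<^sup>2 * (1 / (real n - real m)\<^sup>2)) summable_on {1..} \<times> {1..}"
proof -
  define h where "h = (\<lambda>(m, n). 1 / (real m)\<^sup>2 * (1 / (real n - real m)\<^sup>2))"
  have base: "(\<lambda>(m, d). 1 / (real m)\<^sup>2 * (1 / (real d)\<^sup>2)) summable_on {1..} \<times> {1..}"
    using has_sum_times[OF has_sum_zeta_nat[of 2] has_sum_zeta_nat[of 2]] has_sum_imp_summable by auto
  have "h summable_on {(m, n). 1 \<le> m \<and> m < n} \<longleftrightarrow>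
        (\<lambda>(m, d). 1 / (real m)\<^sup>2 * (1 / (real d)\<^sup>2)) summable_on {1..} \<times> {1..}"
    by (rule summable_on_reindex_bij_witness[of _ "\<lambda>(m, d). (m, m + d)" "\<lambda>(m, n). (m, n - m)"])
       (auto simp: h_def of_nat_diff)
  hence "h summable_on {(m, n). 1 \<le> m \<and> m < n}" using base by simp
  moreover have "h summable_on {(m, n). 1 \<le> n \<and> n < m} \<longleftrightarrow>
        (\<lambda>(m, d). 1 / (real m)\<^sup>2 * (1 / (real d)\<^sup>2)) summable_on {(m, d). 1 \<le> d \<and> d < m}"
    by (rule summable_on_reindex_bij_witness[of _ "\<lambda>(m, d). (m, m - d)" "\<lambda>(m, n). (m, m - n)"])
       (auto simp: h_def of_nat_diff power2_commute)
  moreover have "(\<lambda>(m, d). 1 / (real m)\<^sup>2 * (1 / (real d)\<^sup>2)) summable_on {(m, d). 1 \<le> d \<and> d < m}"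
    using base by (rule summable_on_subset) auto
  ultimately have "h summable_on {(m, n). 1 \<le> m \<and> m < n} \<union> {(m, n). 1 \<le> n \<and> n < m}"
    by (intro summable_on_union) auto
  also have "?this \<longleftrightarrow> h summable_on {1..} \<times> {1..}"
    by (rule summable_on_cong_neutral) (auto simp: h_def)
  finally show ?thesis unfolding h_def .
qed

text \<open>The bound \<open>\<bar>n\<^sup>2 - m\<^sup>2\<bar> \<ge> (n - m)\<^sup>2\<close> and \<open>1 / m ^ k \<le> 1 / m\<^sup>2\<close> give absolute
  convergence over pairs, so the inner sums over \<open>n\<close> evaluate the double sum.\<close>

lemma summable_on_weighted_inverse_square_difference:
  assumes k: "k \<ge> 2"
  shows "(\<lambda>(m, n). 1 / real m ^ k * (1 / ((real n)\<^sup>2 - (real m)\<^sup>2))) summable_on {1..} \<times> {1..}"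
proof (rule abs_summable_summable, rule Infinite_Sum.abs_summable_on_comparison_test)
  let ?h = "\<lambda>(m, n). 1 / (real m)\<^sup>2 * (1 / (real n - real m)\<^sup>2)"
  show "(\<lambda>x. norm (?h x)) summable_on {1..} \<times> {1..}"
    using summable_on_inverse_squared_difference summable_on_iff_abs_summable_on_real by blast
  fix x :: "nat \<times> nat" assume x: "x \<in> {1..} \<times> {1..}"
  obtain m n where mn: "x = (m, n)" "m \<ge> 1" "n \<ge> 1" using x by auto
  have 1: "1 / real m ^ k \<le> 1 / (real m)\<^sup>2"
    using mn k by (intro divide_left_mono power_increasing) auto
  have 2: "1 / \<bar>(real n)\<^sup>2 - (real m)\<^sup>2\<bar> \<le> 1 / (real n - real m)\<^sup>2"
  proof (cases "m = n")
    case False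
    have "(real n)\<^sup>2 - (real m)\<^sup>2 = (real n - real m) * (real n + real m)"
      by (simp add: power2_eq_square algebra_simps)
    moreover have "\<bar>real n - real m\<bar> * \<bar>real n - real m\<bar> \<le> \<bar>real n - real m\<bar> * \<bar>real n + real m\<bar>"
      by (intro mult_left_mono) auto
    ultimately have "(real n - real m)\<^sup>2 \<le> \<bar>(real n)\<^sup>2 - (real m)\<^sup>2\<bar>"
      by (simp add: abs_mult power2_eq_square flip: abs_mult)
    thus ?thesis using False by (intro divide_left_mono) auto
  qed simp
  show "norm (case x of (m, n) \<Rightarrow> 1 / real m ^ k * (1 / ((real n)\<^sup>2 - (real m)\<^sup>2))) \<le> norm (?h x)"
    unfolding mn using mult_mono[OF 1 2] by (simp add: abs_mult)
qed

lemma has_sum_inverse_square_difference: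
  assumes m: "m \<ge> 1"
  shows "((\<lambda>n. 1 / ((real n)\<^sup>2 - (real m)\<^sup>2)) has_sum (3 / (4 * (real m)\<^sup>2))) {1..}"
proof -
  let ?f = "\<lambda>n. 1 / ((real n)\<^sup>2 - (real m)\<^sup>2)"
  have "(\<lambda>n. 1 / real m ^ 2 * ?f n) summable_on {1..}"
    using summable_on_SigmaD1[OF summable_on_weighted_inverse_square_difference[of 2], of m] m by simp
  hence "?f summable_on {1..}"
    using m by (subst (asm) summable_on_cmult_right') auto
  then obtain S where S: "(?f has_sum S) {1..}" by (auto simp: summable_on_def)
  hence "((\<lambda>n. ?f (Suc n)) has_sum S) UNIV"
    by (subst has_sum_reindex_bij_witness[of _ "\<lambda>n. n - 1" Suc "{1..}" ?f _ S]) auto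
  hence "(\<lambda>n. ?f (Suc n)) sums S" by (rule has_sum_imp_sums)
  hence "(\<lambda>N. \<Sum>n<N. ?f (Suc n)) \<longlonglongrightarrow> S" by (simp add: sums_def)
  hence "(\<lambda>N. \<Sum>n<m+N. ?f (Suc n)) \<longlonglongrightarrow> S"
    by (subst add.commute) (rule LIMSEQ_ignore_initial_segment)
  moreover have "(\<Sum>n<m+N. ?f (Suc n)) =
      (3 / (2 * real m) - (\<Sum>i=1..2*m. 1 / real (N + i))) / (2 * real m)" for N
  proof -
    have "(\<Sum>n<m+N. ?f (Suc n)) = (\<Sum>n=1..m+N. ?f n)"
      by (rule sum.reindex_bij_witness[of _ "\<lambda>n. n - 1" Suc]) auto
    thus ?thesis using sum_inverse_square_difference[of m N] m by simp
  qed
  ultimately have 1: "(\<lambda>N. (3 / (2 * real m) - (\<Sum>i=1..2*m. 1 / real (N + i))) / (2 * real m)) \<longlonglongrightarrow> S"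
    by simp
  have "(\<lambda>N. 1 / real (N + i)) \<longlonglongrightarrow> 0" for i
    using LIMSEQ_ignore_initial_segment[OF lim_1_over_n] by auto
  hence "(\<lambda>N. (3 / (2 * real m) - (\<Sum>i=1..2*m. 1 / real (N + i))) / (2 * real m)) \<longlonglongrightarrow>
          (3 / (2 * real m) - (\<Sum>i=1..2*m. 0)) / (2 * real m)"
    using m by (intro tendsto_intros) auto
  with 1 have "S = (3 / (2 * real m) - (\<Sum>i=1..2*m. 0)) / (2 * real m)"
    by (rule LIMSEQ_unique)
  also have "\<dots> = 3 / (4 * (real m)\<^sup>2)" by (simp add: power2_eq_square)
  finally show ?thesis using S by simp
qed

lemma has_sum_weighted_inverse_square_difference:
  assumes k: "k \<ge> 2"
  shows "((\<lambda>(m, n). 1 / real m ^ k * (1 / ((real n)\<^sup>2 - (real m)\<^sup>2))) has_sum (3 / 4 * zeta_nat (k + 2)))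
           ({1..} \<times> {1..})"
proof (rule has_sum_SigmaI)
  show "((\<lambda>n. case (m, n) of (m, n) \<Rightarrow> 1 / real m ^ k * (1 / ((real n)\<^sup>2 - (real m)\<^sup>2))) has_sum
          (1 / real m ^ k * (3 / (4 * (real m)\<^sup>2)))) {1..}" if "m \<in> {1..}" for m
    using has_sum_cmult_right[OF has_sum_inverse_square_difference[of m], of "1 / real m ^ k"] that
    by simp
  have "((\<lambda>m. 3 / 4 * (1 / real m ^ (k + 2))) has_sum (3 / 4 * zeta_nat (k + 2))) {1..}"
    by (intro has_sum_cmult_right has_sum_zeta_nat) simp
  thus "((\<lambda>m. 1 / real m ^ k * (3 / (4 * (real m)\<^sup>2))) has_sum (3 / 4 * zeta_nat (k + 2))) {1..}"
    by (simp add: power_add power2_eq_square mult_ac)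
qed (rule summable_on_weighted_inverse_square_difference[OF k])

text \<open>This is the finite geometric sum with ratio \<open>b / a\<close>, written so that its two boundary terms are exchanged
  by swapping \<open>a\<close> and \<open>b\<close>.\<close>

lemma geometric_partial_fractions:
  fixes a b :: real
  assumes "a \<noteq> 0" "b \<noteq> 0" "a \<noteq> b"
  shows "(\<Sum>j=1..<Suc k. 1 / a ^ j * (1 / b ^ (Suc k - j))) =
           1 / a ^ k * (1 / (b - a)) + 1 / b ^ k * (1 / (a - b))"
proof (induction k)
  case (Suc k)
  have "(\<Sum>j=1..<Suc (Suc k). 1 / a ^ j * (1 / b ^ (Suc (Suc k) - j))) =
     (\<Sum>j=1..<Suc k. 1 / a ^ j * (1 / b ^ (Suc (Suc k) - j))) + 1 / a ^ Suc k * (1 / b)"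
    by simp
  also have "(\<Sum>j=1..<Suc k. 1 / a ^ j * (1 / b ^ (Suc (Suc k) - j))) =
     (\<Sum>j=1..<Suc k. 1 / a ^ j * (1 / b ^ (Suc k - j))) / b"
    unfolding sum_divide_distrib by (intro sum.cong) (auto simp: Suc_diff_le)
  also note Suc.IH
  also have "(1 / a ^ k * (1 / (b - a)) + 1 / b ^ k * (1 / (a - b))) / b + 1 / a ^ Suc k * (1 / b) =
     1 / a ^ Suc k * (1 / (b - a)) + 1 / b ^ Suc k * (1 / (a - b))"
  proof -
    have "1 / (b - a) = - 1 / (a - b)" using assms by (simp add: field_simps)
    thus ?thesis using assms by (simp add: divide_simps) (simp add: algebra_simps)
  qed
  finally show ?case .
qed (use assms in \<open>auto simp: field_simps\<close>)

lemma has_sum_sum: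
  fixes f :: "'i \<Rightarrow> 'a \<Rightarrow> real"
  assumes "finite I" "\<And>i. i \<in> I \<Longrightarrow> (f i has_sum S i) A"
  shows "((\<lambda>x. \<Sum>i\<in>I. f i x) has_sum (\<Sum>i\<in>I. S i)) A"
  using assms by (induction I rule: finite_induct) (auto intro: has_sum_add)

text \<open>Expand the right-hand side as a sum over pairs \<open>(m, n)\<close>. The diagonal contributes \<open>(k - 1) \<zeta>(2k)\<close>. Off the
  diagonal, partial fractions with \<open>a = m\<^sup>2\<close> and \<open>b = n\<^sup>2\<close> give a function of \<open>(m, n)\<close> plus its mirror image,
  each of sum \<open>3/4 \<zeta>(2k)\<close>. The total is \<open>(k - 1 + 3/2) \<zeta>(2k)\<close>.\<close>

theorem zeta_nat_even_recurrence:
  assumes k2: "k \<ge> 2"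
  shows "(real k + 1 / 2) * zeta_nat (2 * k) = (\<Sum>j=1..<k. zeta_nat (2 * j) * zeta_nat (2 * (k - j)))"
proof -
  obtain l where k: "k = l + 2" using k2 by (metis add.commute le_Suc_ex)
  \<comment> \<open>\<open>F\<close> vanishes on the diagonal because \<open>1 / 0 = 0\<close>; \<open>D\<close> carries the diagonal terms.\<close>
  define F where "F = (\<lambda>(m, n). 1 / real m ^ (2 * (l + 1)) * (1 / ((real n)\<^sup>2 - (real m)\<^sup>2)))"
  define D where "D = (\<lambda>(m, n). if m = n then real (l + 1) * (1 / real m ^ (2 * (l + 2))) else 0)"
  have F: "(F has_sum (3 / 4 * zeta_nat (2 * (l + 2)))) ({1..} \<times> {1..})"
    using has_sum_weighted_inverse_square_difference[of "2 * (l + 1)"] by (simp add: F_def)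
  hence F': "((\<lambda>(m, n). F (n, m)) has_sum (3 / 4 * zeta_nat (2 * (l + 2)))) ({1..} \<times> {1..})"
    by (subst (asm) has_sum_swap)
  have "(D has_sum (real (l + 1) * zeta_nat (2 * (l + 2)))) {(m, n). m = n \<and> 1 \<le> m} \<longleftrightarrow>
        ((\<lambda>m. real (l + 1) * (1 / real m ^ (2 * (l + 2)))) has_sum (real (l + 1) * zeta_nat (2 * (l + 2)))) {1..}"
    by (rule has_sum_reindex_bij_witness[of _ "\<lambda>m. (m, m)" fst]) (auto simp: D_def)
  also have \<dots> by (intro has_sum_cmult_right has_sum_zeta_nat) simp
  also have "(D has_sum (real (l + 1) * zeta_nat (2 * (l + 2)))) {(m, n). m = n \<and> 1 \<le> m} \<longleftrightarrow>
        (D has_sum (real (l + 1) * zeta_nat (2 * (l + 2)))) ({1..} \<times> {1..})"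
    by (rule has_sum_cong_neutral) (auto simp: D_def split: if_splits)
  finally have D: "(D has_sum (real (l + 1) * zeta_nat (2 * (l + 2)))) ({1..} \<times> {1..})" by simp
  have "((\<lambda>(m, n). \<Sum>j=1..<l+2. 1 / real m ^ (2 * j) * (1 / real n ^ (2 * (l + 2 - j)))) has_sum
          (\<Sum>j=1..<l+2. zeta_nat (2 * j) * zeta_nat (2 * (l + 2 - j)))) ({1..} \<times> {1..})"
    unfolding case_prod_unfold
    by (intro has_sum_sum has_sum_times[unfolded case_prod_unfold] has_sum_zeta_nat) auto
  also have "?this \<longleftrightarrow> ((\<lambda>x. F x + (case x of (m, n) \<Rightarrow> F (n, m)) + D x) has_sum
          (\<Sum>j=1..<l+2. zeta_nat (2 * j) * zeta_nat (2 * (l + 2 - j)))) ({1..} \<times> {1..})"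
  proof (rule has_sum_cong)
    fix x :: "nat \<times> nat" assume "x \<in> {1..} \<times> {1..}"
    then obtain m n where x: "x = (m, n)" and mn: "m \<ge> 1" "n \<ge> 1" by auto
    have "(\<Sum>j=1..<l+2. 1 / real m ^ (2 * j) * (1 / real n ^ (2 * (l + 2 - j)))) = F (m, n) + F (n, m) + D (m, n)"
    proof (cases "m = n")
      case True
      have "(\<Sum>j=1..<l+2. 1 / real m ^ (2 * j) * (1 / real n ^ (2 * (l + 2 - j)))) =
            (\<Sum>j=1..<l+2. 1 / real m ^ (2 * (l + 2)))"
        using True by (intro sum.cong) (auto simp del: mult_Suc_right simp flip: power_add distrib_left)
      thus ?thesis using True by (simp add: F_def D_def)
    next
      case False
      have "(\<Sum>j=1..<l+2. 1 / real m ^ (2 * j) * (1 / real n ^ (2 * (l + 2 - j)))) =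
        (\<Sum>j=1..<Suc (l+1). 1 / ((real m)\<^sup>2) ^ j * (1 / ((real n)\<^sup>2) ^ (Suc (l + 1) - j)))"
        by (intro sum.cong) (simp_all add: power_mult)
      also have "\<dots> = 1 / ((real m)\<^sup>2) ^ (l + 1) * (1 / ((real n)\<^sup>2 - (real m)\<^sup>2)) +
          1 / ((real n)\<^sup>2) ^ (l + 1) * (1 / ((real m)\<^sup>2 - (real n)\<^sup>2))"
        using mn False by (intro geometric_partial_fractions) auto
      also have "\<dots> = F (m, n) + F (n, m) + D (m, n)"
        unfolding F_def D_def using False by (simp only: power_mult prod.case if_False add_0_right)
      finally show ?thesis .
    qed
    thus "(case x of (m, n) \<Rightarrow> \<Sum>j=1..<l+2. 1 / real m ^ (2 * j) * (1 / real n ^ (2 * (l + 2 - j)))) =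
        F x + (case x of (m, n) \<Rightarrow> F (n, m)) + D x"
      by (simp only: x prod.case)
  qed
  finally have "(\<Sum>j=1..<l+2. zeta_nat (2 * j) * zeta_nat (2 * (l + 2 - j))) =
      3 / 4 * zeta_nat (2 * (l + 2)) + 3 / 4 * zeta_nat (2 * (l + 2)) + real (l + 1) * zeta_nat (2 * (l + 2))"
    by (rule has_sum_unique) (intro has_sum_add F F' D)
  thus ?thesis unfolding k by (simp add: algebra_simps)
qed

lemma zeta_nat_4: "zeta_nat 4 = pi ^ 4 / 90"
proof -
  have "{1..<2} = {1 :: nat}" by auto
  thus ?thesis
    using zeta_nat_even_recurrence[of 2]
    by (simp add: zeta_nat_2 flip: power_add)
qed

lemma zeta_nat_6: "zeta_nat 6 = pi ^ 6 / 945"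
proof -
  have "{1..<3} = {1, 2 :: nat}" by auto
  thus ?thesis
    using zeta_nat_even_recurrence[of 3]
    by (simp add: zeta_nat_2 zeta_nat_4 flip: power_add)
qed

lemma zeta_nat_8: "zeta_nat 8 = pi ^ 8 / 9450"
proof -
  have "{1..<4} = {1, 2, 3 :: nat}" by auto
  thus ?thesis
    using zeta_nat_even_recurrence[of 4]
    by (simp add: zeta_nat_2 zeta_nat_4 zeta_nat_6 flip: power_add)
qed

lemma zeta_nat_10: "zeta_nat 10 = pi ^ 10 / 93555"
proof -
  have "{1..<5} = {1, 2, 3, 4 :: nat}" by auto
  thus ?thesis
    using zeta_nat_even_recurrence[of 5]
    by (simp add: zeta_nat_2 zeta_nat_4 zeta_nat_6 zeta_nat_8 flip: power_add)
qed

lemma zeta_nat_12: "zeta_nat 12 = 691 * pi ^ 12 / 638512875"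
proof -
  have "{1..<6} = {1, 2, 3, 4, 5 :: nat}" by auto
  thus ?thesis
    using zeta_nat_even_recurrence[of 6]
    by (simp add: zeta_nat_2 zeta_nat_4 zeta_nat_6 zeta_nat_8 zeta_nat_10 flip: power_add)
qed

lemma zeta_nat_14: "zeta_nat 14 = 2 * pi ^ 14 / 18243225"
proof -
  have "{1..<7} = {1, 2, 3, 4, 5, 6 :: nat}" by auto
  thus ?thesis
    using zeta_nat_even_recurrence[of 7]
    by (simp add: zeta_nat_2 zeta_nat_4 zeta_nat_6 zeta_nat_8 zeta_nat_10 zeta_nat_12 flip: power_add)
qed

lemma zeta_nat_16: "zeta_nat 16 = 3617 * pi ^ 16 / 325641566250"
proof -
  have "{1..<8} = {1, 2, 3, 4, 5, 6, 7 :: nat}" by auto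
  thus ?thesis
    using zeta_nat_even_recurrence[of 8]
    by (simp add: zeta_nat_2 zeta_nat_4 zeta_nat_6 zeta_nat_8 zeta_nat_10 zeta_nat_12 zeta_nat_14 flip: power_add)
qed

lemma zeta_nat_18: "zeta_nat 18 = 43867 * pi ^ 18 / 38979295480125"
proof -
  have "{1..<9} = {1, 2, 3, 4, 5, 6, 7, 8 :: nat}" by auto
  thus ?thesis
    using zeta_nat_even_recurrence[of 9]
    by (simp add: zeta_nat_2 zeta_nat_4 zeta_nat_6 zeta_nat_8 zeta_nat_10 zeta_nat_12 zeta_nat_14 zeta_nat_16 flip: power_add)
qed

lemma zeta_nat_20: "zeta_nat 20 = 174611 * pi ^ 20 / 1531329465290625"
proof -
  have "{1..<10} = {1, 2, 3, 4, 5, 6, 7, 8, 9 :: nat}" by auto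
  thus ?thesis
    using zeta_nat_even_recurrence[of 10]
    by (simp add: zeta_nat_2 zeta_nat_4 zeta_nat_6 zeta_nat_8 zeta_nat_10 zeta_nat_12 zeta_nat_14 zeta_nat_16 zeta_nat_18 flip: power_add)
qed

section \<open>Dirichlet series\<close>

lemma summable_on_liouville:
  assumes "s \<ge> 2"
  shows "(\<lambda>n. real_of_int (liouville n) / real n ^ s) summable_on {1..}"
proof (rule abs_summable_summable)
  have "norm (real_of_int (liouville n) / real n ^ s) = 1 / real n ^ s" for n
    using liouville_cases[of n] by auto
  hence "(\<lambda>n. norm (real_of_int (liouville n) / real n ^ s)) = (\<lambda>n. 1 / real n ^ s)" by blast
  thus "(\<lambda>n. norm (real_of_int (liouville n) / real n ^ s)) summable_on {1..}"
    using has_sum_zeta_nat[OF assms] by (simp only: has_sum_imp_summable)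
qed

text \<open>Multiplying by \<open>\<zeta>(s)\<close> and collecting the pairs \<open>(d, e)\<close> with \<open>d * e = n\<close> turns the coefficients into
  divisor sums of \<open>\<lambda>\<close>, so only squares remain and the product is \<open>\<zeta>(2s)\<close>.\<close>

theorem has_sum_liouville:
  assumes s: "s \<ge> 2"
  shows "((\<lambda>n. real_of_int (liouville n) / real n ^ s) has_sum (zeta_nat (2 * s) / zeta_nat s)) {1..}"
proof -
  obtain L where L: "((\<lambda>n. real_of_int (liouville n) / real n ^ s) has_sum L) {1..}"
    using summable_on_liouville[OF s] by (auto simp: summable_on_def)
  define S where "S = (SIGMA n:{1::nat..}. {d. d dvd n})"
  have "((\<lambda>(d, e). real_of_int (liouville d) / real d ^ s * (1 / real e ^ s)) has_sum (L * zeta_nat s))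
          ({1..} \<times> {1..})"
    using L has_sum_zeta_nat[OF s] by (rule has_sum_times)
  also have "?this \<longleftrightarrow> ((\<lambda>(n, d). real_of_int (liouville d) / real n ^ s) has_sum (L * zeta_nat s)) S"
    by (rule has_sum_reindex_bij_witness[of _ "\<lambda>(n, d). (d, n div d)" "\<lambda>(d, e). (d * e, d)"])
       (auto simp: S_def power_mult_distrib Suc_le_eq div_greater_zero_iff dvd_imp_le dvd_pos_nat)
  finally have "((\<lambda>n. \<Sum>d | d dvd n. real_of_int (liouville d) / real n ^ s) has_sum (L * zeta_nat s)) {1..}"
    unfolding S_def by (rule has_sum_SigmaD) (auto intro!: has_sum_finiteI)
  also have "?this \<longleftrightarrow> ((\<lambda>n. of_bool (is_nth_power 2 n) / real n ^ s) has_sum (L * zeta_nat s)) {1..}"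
  proof (rule has_sum_cong)
    fix n :: nat assume "n \<in> {1..}"
    hence "(\<Sum>d | d dvd n. real_of_int (liouville d)) = of_bool (is_nth_power 2 n)"
      using liouville_divisor_sum[of n] by (simp flip: of_int_sum)
    thus "(\<Sum>d | d dvd n. real_of_int (liouville d) / real n ^ s) = of_bool (is_nth_power 2 n) / real n ^ s"
      by (simp flip: sum_divide_distrib)
  qed
  finally have "((\<lambda>n. of_bool (is_nth_power 2 n) / real n ^ s) has_sum (L * zeta_nat s)) {1..}" .
  moreover have "((\<lambda>n. of_bool (is_nth_power 2 n) / real n ^ s) has_sum zeta_nat (2 * s)) {1..}"
  proof -
    have "((\<lambda>n. 1 / real n ^ (2 * s)) has_sum zeta_nat (2 * s)) {1..}"
      using s by (intro has_sum_zeta_nat) simp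
    also have "(\<lambda>n. 1 / real n ^ (2 * s)) = (\<lambda>n. of_bool (is_nth_power 2 (n\<^sup>2)) / real (n\<^sup>2) ^ s)"
      by (simp add: power_mult)
    also have "(\<dots> has_sum zeta_nat (2 * s)) {1..} \<longleftrightarrow>
        ((\<lambda>n. of_bool (is_nth_power 2 n) / real n ^ s) has_sum zeta_nat (2 * s)) ((\<lambda>n. n\<^sup>2) ` {1..})"
      by (rule has_sum_reindex_bij_betw) (auto simp: bij_betw_def inj_on_def)
    also have "\<dots> \<longleftrightarrow> ((\<lambda>n. of_bool (is_nth_power 2 n) / real n ^ s) has_sum zeta_nat (2 * s)) {1..}"
    proof (rule has_sum_cong_neutral)
      fix n :: nat assume n: "n \<in> {1..} - (\<lambda>n. n\<^sup>2) ` {1..}"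
      have "\<not> is_nth_power 2 n"
      proof
        assume "is_nth_power 2 n"
        then obtain k where "n = k\<^sup>2" by (rule is_nth_powerE)
        with n show False by (cases "k = 0") auto
      qed
      thus "of_bool (is_nth_power 2 n) / real n ^ s = 0" by simp
    qed (auto simp: Suc_le_eq)
    finally show ?thesis .
  qed
  ultimately have "L * zeta_nat s = zeta_nat (2 * s)" by (rule has_sum_unique)
  hence "L = zeta_nat (2 * s) / zeta_nat s"
    using zeta_nat_pos[OF s] by (simp add: field_simps)
  with L show ?thesis by simp
qed

text \<open>The Liouville series factors along \<open>n = d ^ r * m\<close>, and the series over \<open>d\<close> is \<open>\<zeta>(rs)\<close> for
  even \<open>r\<close> and a Liouville series at \<open>r * s\<close> for odd \<open>r\<close>; dividing by it isolates the sum over the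
  \<open>r\<close>-free \<open>m\<close>.\<close>

theorem has_sum_moebius_rank:
  assumes r: "r > 0" and s: "s \<ge> 2"
  shows "((\<lambda>n. real_of_int (moebius_rank r n) / real n ^ s) has_sum
           (if even r then zeta_nat (2 * s) / (zeta_nat s * zeta_nat (r * s))
            else zeta_nat (2 * s) * zeta_nat (r * s) / (zeta_nat s * zeta_nat (2 * (r * s)))))
         {n. r_free r n}"
proof -
  have "1 * 2 \<le> r * s" using r s by (intro mult_le_mono) auto
  hence rs: "r * s \<ge> 2" by simp
  have pos: "zeta_nat (2 * (r * s)) > 0" by (rule zeta_nat_pos) (use rs in linarith)
  have "{n. r_free r n} \<subseteq> {1..}" by (auto simp: r_free_def)
  hence "(\<lambda>n. real_of_int (liouville n) / real n ^ s) summable_on {n. r_free r n}"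
    by (rule summable_on_subset[OF summable_on_liouville[OF s]])
  then obtain S where S: "((\<lambda>n. real_of_int (liouville n) / real n ^ s) has_sum S) {n. r_free r n}"
    by (auto simp: summable_on_def)
  define D where "D = (if even r then zeta_nat (r * s) else zeta_nat (2 * (r * s)) / zeta_nat (r * s))"
  have "((\<lambda>d. real_of_int (liouville d ^ r) / real d ^ (r * s)) has_sum D) {1..}"
    unfolding D_def liouville_power_parity
    using has_sum_zeta_nat[OF rs] has_sum_liouville[OF rs] by auto
  hence "((\<lambda>(d, m). real_of_int (liouville d ^ r) / real d ^ (r * s) * (real_of_int (liouville m) / real m ^ s))
           has_sum (D * S)) ({1..} \<times> {m. r_free r m})"
    using S by (rule has_sum_times)
  also have "?this \<longleftrightarrow> ((\<lambda>x. real_of_int (liouville (case x of (d, m) \<Rightarrow> d ^ r * m)) /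
           real (case x of (d, m) \<Rightarrow> d ^ r * m) ^ s) has_sum (D * S)) ({1..} \<times> {m. r_free r m})"
    by (rule has_sum_cong)
       (auto simp: liouville_mult liouville_power r_free_def power_mult_distrib power_mult Suc_le_eq)
  also have "\<dots> \<longleftrightarrow> ((\<lambda>n. real_of_int (liouville n) / real n ^ s) has_sum (D * S)) {1..}"
    by (rule has_sum_reindex_bij_betw) (rule bij_betw_power_times_r_free[OF r])
  finally have "D * S = zeta_nat (2 * s) / zeta_nat s"
    using has_sum_liouville[OF s] by (rule has_sum_unique)
  hence "S = (if even r then zeta_nat (2 * s) / (zeta_nat s * zeta_nat (r * s))
            else zeta_nat (2 * s) * zeta_nat (r * s) / (zeta_nat s * zeta_nat (2 * (r * s))))"
    using zeta_nat_pos[OF s] zeta_nat_pos[OF rs] pos unfolding D_def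
    by (simp add: field_simps split: if_splits)
  moreover have "((\<lambda>n. real_of_int (moebius_rank r n) / real n ^ s) has_sum S) {n. r_free r n}"
    using S by (subst has_sum_cong) (auto simp: moebius_rank_eq_liouville)
  ultimately show ?thesis by simp
qed

theorem theorem1p1:
  "((\<lambda>n::nat. real_of_int (moebius_rank 3 n) / (real n)\<^sup>2) has_sum (45045 / (691 * pi ^ 4)))
     {n. r_free 3 n} \<and>
   ((\<lambda>n::nat. real_of_int (moebius_rank 4 n) / (real n)\<^sup>2) has_sum (630 / pi ^ 6))
     {n. r_free 4 n} \<and>
   ((\<lambda>n::nat. real_of_int (moebius_rank 5 n) / (real n)\<^sup>2) has_sum (1091215125 / (174611 * pi ^ 8)))
     {n. r_free 5 n}"
proof (intro conjI)
  have "zeta_nat 4 * zeta_nat 6 / (zeta_nat 2 * zeta_nat 12) = 45045 / (691 * pi ^ 4)"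
    by (simp add: zeta_nat_2 zeta_nat_4 zeta_nat_6 zeta_nat_12 field_simps flip: power_add)
  thus "((\<lambda>n::nat. real_of_int (moebius_rank 3 n) / (real n)\<^sup>2) has_sum (45045 / (691 * pi ^ 4)))
          {n. r_free 3 n}"
    using has_sum_moebius_rank[of 3 2] by simp
  have "zeta_nat 4 / (zeta_nat 2 * zeta_nat 8) = 630 / pi ^ 6"
    by (simp add: zeta_nat_2 zeta_nat_4 zeta_nat_8 field_simps flip: power_add)
  thus "((\<lambda>n::nat. real_of_int (moebius_rank 4 n) / (real n)\<^sup>2) has_sum (630 / pi ^ 6)) {n. r_free 4 n}"
    using has_sum_moebius_rank[of 4 2] by simp
  have "zeta_nat 4 * zeta_nat 10 / (zeta_nat 2 * zeta_nat 20) = 1091215125 / (174611 * pi ^ 8)"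
    by (simp add: zeta_nat_2 zeta_nat_4 zeta_nat_10 zeta_nat_20 field_simps flip: power_add)
  thus "((\<lambda>n::nat. real_of_int (moebius_rank 5 n) / (real n)\<^sup>2) has_sum (1091215125 / (174611 * pi ^ 8)))
          {n. r_free 5 n}"
    using has_sum_moebius_rank[of 5 2] by simp
qed

end
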